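(* Let the isosceles triangle $ABC$ with base angles $\alpha$ be $N$-tiled by a tile with angles $(\alpha,\beta,2\alpha)$, where $\alpha$ is not a rational multiple of $\pi$. Then the tile is rational; that is, the ratios of its side lengths are rational.
   Context: An $N$-tiling of a triangle $ABC$ by a triangle $T$ (the tile) is a set of $N$ triangles congruent to $T$ (reflections allowed) whose interiors are pairwise disjoint and whose union is $ABC$ (tiles need not meet edge to edge). "Isosceles" means exactly two sides are equal; the base angles are the two equal angles. *)

theory Defs
  imports "HOL-Analysis.Analysis"
begin

text \<open>The first argument is the vertex: \<open>angle_at Y X Z\<close> is the unoriented angle \<open>XYZ\<close>.\<close>

definition angle_at :: "real^2 \<Rightarrow> real^2 \<Rightarrow> real^2 \<Rightarrow> real" where
  "angle_at Y X Z = arccos (((X - Y) \<bullet> (Z - Y)) / (norm (X - Y) * norm (Z - Y)))"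

definition proper_triangle :: "real^2 \<Rightarrow> real^2 \<Rightarrow> real^2 \<Rightarrow> bool" where
  "proper_triangle X Y Z \<longleftrightarrow> \<not> collinear {X, Y, Z}"

text \<open>Isosceles with base \<open>XY\<close> and apex \<open>Z\<close>: exactly two sides are equal, so equilateral triangles
  are excluded.\<close>

definition isosceles_triangle :: "real^2 \<Rightarrow> real^2 \<Rightarrow> real^2 \<Rightarrow> bool" where
  "isosceles_triangle X Y Z \<longleftrightarrow>
     proper_triangle X Y Z \<and> dist X Z = dist Y Z \<and> dist X Y \<noteq> dist X Z"

text \<open>The map \<open>f\<close> need not preserve orientation, so reflected copies are allowed.\<close>

definition congruent_sets :: "(real^2) set \<Rightarrow> (real^2) set \<Rightarrow> bool" where
  "congruent_sets S T \<longleftrightarrow>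
     (\<exists>f :: real^2 \<Rightarrow> real^2. (\<forall>x y. dist (f x) (f y) = dist x y) \<and> f ` S = T)"

text \<open>\<open>S\<close> and \<open>T\<close> are filled, closed triangles. Finiteness is explicit because \<open>card\<close> is 0 on
  infinite sets.\<close>

definition is_tiling :: "nat \<Rightarrow> (real^2) set set \<Rightarrow> (real^2) set \<Rightarrow> (real^2) set \<Rightarrow> bool" where
  "is_tiling N \<T> S T \<longleftrightarrow>
     finite \<T> \<and> card \<T> = N \<and> (\<forall>t\<in>\<T>. congruent_sets T t) \<and>
     pairwise (\<lambda>s t. interior s \<inter> interior t = {}) \<T> \<and> \<Union>\<T> = S"

definition rational_triangle :: "real^2 \<Rightarrow> real^2 \<Rightarrow> real^2 \<Rightarrow> bool" where
  "rational_triangle X Y Z \<longleftrightarrow>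
     dist X Y / dist Y Z \<in> \<rat> \<and> dist Y Z / dist Z X \<in> \<rat> \<and> dist Z X / dist X Y \<in> \<rat>"

end

theory Submission
  imports Defs
begin

text \<open>Fix a direction. For a triangle whose boundary is run through anticlockwise, take the length of the
  edge in this direction minus the length of the edge in the opposite direction. This number is
  additive over tilings: a piece of an edge in the interior of the tiled triangle is covered from both
  sides, with opposite signs. It is proved by comparing the sum of the indicators of the tiles just
  above and just below a line (\<open>jumps_at_cofinite\<close>) and integrating along the line
  (\<open>horizontal_boundary_additive\<close>, \<open>directed_boundary_additive\<close>).

  Put x = 2 cos \<alpha>. The sides of the tile opposite to \<alpha>, \<beta>, 2\<alpha> are in the ratio 1 : x^2 - 1 : x
  (\<open>tile_sides\<close>), so the claim is that x is rational. Write t^k for the direction at angle k\<alpha> to the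
  base of \<open>ABC\<close>, and count a tile lying the opposite way with the sign -1. Since \<alpha>/\<pi> is irrational,
  these directions are distinct, and additivity becomes an identity between Laurent polynomials in t:
  P(t) (x + t^3 - (x^2-1)t) + Q(t) ((x^2-1) - t^(-2) - xt) = M (x - t - 1/t). Here P and Q have integer
  coefficients, which count the direct and the reflected tiles by direction, and M > 0 is the leg of
  \<open>ABC\<close> divided by the side of the tile opposite to \<alpha>.

  Everything is divisible by t^2 - xt + 1, and the quotient is
  P(t)(t + x) - Q(t) t^(-2) (1 + xt) = -M/t. If x were irrational, 1 and x would be linearly independent
  over the rationals. Comparing coefficients gives M = m + nx with integers m, n, and
  tP - t^(-2) Q = -m/t, P - Q/t = -n/t. Eliminating Q gives P(t)(t^2 - 1) = n/t - m, and t = 1, -1 give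
  m = n = 0. So M = 0, which is absurd (\<open>direction_equations_imp_zero\<close>, which reads this off from
  the coefficients).\<close>

section \<open>Counting edges by direction\<close>

text \<open>At the smallest index in the support, the recurrence leaves only the leading term.\<close>

lemma finite_support_linear_recurrence:
  fixes D :: "int \<Rightarrow> real"
  assumes fin: "finite {k. D k \<noteq> 0}"
    and rec: "\<And>k. D k - x * D (k - 1) + D (k - 2) = 0"
  shows "D k = 0"
proof (rule ccontr)
  assume "D k \<noteq> 0"
  then have ne: "{k. D k \<noteq> 0} \<noteq> {}" by auto
  define m where "m = Min {k. D k \<noteq> 0}"
  have "D m \<noteq> 0"
    using Min_in[OF fin ne] by (simp add: m_def)
  moreover have "D j = 0" if "j < m" for j
    using Min_le[OF fin, of j] that by (force simp: m_def)
  ultimately show False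
    using rec[of m] by simp
qed

lemma finite_support_shift_zero:
  fixes p :: "int \<Rightarrow> int"
  assumes fin: "finite {k. p k \<noteq> 0}" and "d \<noteq> 0"
    and shift: "\<And>n. p (j + d * int n) = p (j + d * int (Suc n))"
  shows "p j = 0"
proof (rule ccontr)
  assume nz: "p j \<noteq> 0"
  have eq: "p (j + d * int n) = p j" for n
    by (induction n) (use shift in auto)
  have "inj (\<lambda>n. j + d * int n)"
    using \<open>d \<noteq> 0\<close> by (auto intro: injI)
  then have "infinite (range (\<lambda>n. j + d * int n))"
    by (rule range_inj_infinite)
  moreover have "range (\<lambda>n. j + d * int n) \<subseteq> {k. p k \<noteq> 0}"
    using eq nz by auto
  ultimately show False
    using fin finite_subset by blast
qed

lemma irrational_lin_indep:
  fixes a b :: int and x :: real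
  assumes "x \<notin> \<rat>" and "of_int a + x * of_int b = 0"
  shows "a = 0 \<and> b = 0"
proof -
  have "b = 0"
  proof (rule ccontr)
    assume "b \<noteq> 0"
    then have "x = - of_int a / of_int b"
      using assms(2) by (simp add: field_simps)
    then show False
      using assms(1) by simp
  qed
  then show ?thesis using assms(2) by simp
qed

text \<open>Let x = 2 cos \<alpha> and write t^k for the direction at angle k\<alpha>. Scaled so that the side opposite \<alpha>
  is 1, a tile has sides 1, x^2 - 1, x. Its anticlockwise boundary is x + t^3 - (x^2 - 1)t if it is
  placed directly, and (x^2 - 1) - t^(-2) - xt if it is reflected, each multiplied by the direction of
  its first edge. If \<open>d\<close> counts tiles by the direction of that edge, the two functions below are the
  coefficients of t^k in the total boundary.\<close>

definition direct_outline :: "real \<Rightarrow> (int \<Rightarrow> int) \<Rightarrow> int \<Rightarrow> real" where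
  "direct_outline x d k = x * d k + d (k - 3) - (x\<^sup>2 - 1) * d (k - 1)"

definition reflected_outline :: "real \<Rightarrow> (int \<Rightarrow> int) \<Rightarrow> int \<Rightarrow> real" where
  "reflected_outline x d k = (x\<^sup>2 - 1) * d k - d (k + 2) - x * d (k - 1)"

lemma direct_outline_sum:
  "direct_outline x (\<lambda>j. \<Sum>t\<in>S. d t j) k = (\<Sum>t\<in>S. direct_outline x (d t) k)"
  by (simp add: direct_outline_def sum.distrib sum_subtractf sum_distrib_left)

lemma reflected_outline_sum:
  "reflected_outline x (\<lambda>j. \<Sum>t\<in>S. d t j) k = (\<Sum>t\<in>S. reflected_outline x (d t) k)"
  by (simp add: reflected_outline_def sum.distrib sum_subtractf sum_distrib_left)

text \<open>The right-hand side lists the coefficients of the boundary M(x - t - 1/t) of the isosceles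
  triangle. All three boundaries are divisible by t^2 - xt + 1, because each closes up at
  t = e^(i \<alpha>) and at its conjugate; the coefficients of the quotient are \<open>D\<close> below. Dividing leaves
  P(t)(t + x) - Q(t) t^(-2) (1 + xt) = -M/t with integral P, Q. As 1 and x are linearly
  independent over the rationals, this single identity splits into two, which force
  P = Q = 0 and hence M = 0.\<close>

lemma direction_equations_imp_zero:
  fixes p q :: "int \<Rightarrow> int" and x M :: real
  assumes finp: "finite {k. p k \<noteq> 0}" and finq: "finite {k. q k \<noteq> 0}"
    and irr: "x \<notin> \<rat>"
    and eq: "\<And>k. direct_outline x p k + reflected_outline x q k
       = M * (x * of_bool (k = 0) - of_bool (k = 1) - of_bool (k = -1))"
  shows "M = 0"
proof -
  define D where "D k = p (k - 1) + x * p k - q (k + 2) - x * q (k + 1)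
      + M * of_bool (k = -1)" for k :: int
  \<comment> \<open>Cancelling the factor t^2 - xt + 1: the recurrence says that multiplying \<open>D\<close> by it gives 0.\<close>
  have D0: "D k = 0" for k
  proof (rule finite_support_linear_recurrence)
    have "{k. D k \<noteq> 0} \<subseteq> (\<lambda>k. k + 1) ` {k. p k \<noteq> 0} \<union> {k. p k \<noteq> 0}
        \<union> (\<lambda>k. k - 2) ` {k. q k \<noteq> 0} \<union> (\<lambda>k. k - 1) ` {k. q k \<noteq> 0} \<union> {-1}"
      (is "_ \<subseteq> ?U")
    proof
      fix k assume k: "k \<in> {k. D k \<noteq> 0}"
      show "k \<in> ?U"
      proof (rule ccontr)
        assume n: "k \<notin> ?U"
        have "p (k - 1) = 0" "q (k + 2) = 0" "q (k + 1) = 0"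
          using n by (force simp: image_iff)+
        with n k show False by (simp add: D_def)
      qed
    qed
    then show "finite {k. D k \<noteq> 0}"
      by (rule finite_subset) (use finp finq in auto)
    show "D k - x * D (k - 1) + D (k - 2) = 0" for k
    proof -
      have i: "k - 1 - 1 = k - 2" "k - 2 - 1 = k - 3" "k - 1 + 2 = k + 1" "k - 2 + 2 = k"
        "k - 1 + 1 = k" "k - 2 + 1 = k - 1" by auto
      have "M * (x * of_bool (k = 0) - of_bool (k = 1) - of_bool (k = -1)) =
         M * (x * of_bool (k - 1 = - 1) - of_bool (k - 2 = - 1) - of_bool (k = -1))"
        by (auto simp: of_bool_def)
      then show ?thesis
        using eq[of k] unfolding D_def i direct_outline_def reflected_outline_def by (simp add: algebra_simps power2_eq_square)
    qed
  qed
  \<comment> \<open>Away from the exponent -1 the coefficient of M is absent, so the integer parts vanish separately.\<close>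
  have rel: "p (k - 1) = q (k + 2)" "p k = q (k + 1)" if "k \<noteq> -1" for k
  proof -
    have "of_int (p (k - 1) - q (k + 2)) + x * of_int (p k - q (k + 1)) = 0"
      using D0[of k] that by (simp add: D_def algebra_simps)
    from irrational_lin_indep[OF irr this]
    show "p (k - 1) = q (k + 2)" "p k = q (k + 1)" by auto
  qed
  have step: "p j = p (j + 2)" if "j \<noteq> -2" "j \<noteq> -3" for j
    using rel(1)[of "j + 1"] rel(2)[of "j + 2"] that by (simp add: add.commute)
  have p0: "p j = 0" for j
  proof (cases "j \<ge> -1")
    case True
    show ?thesis
    proof (rule finite_support_shift_zero[OF finp, of 2])
      fix n
      show "p (j + 2 * int n) = p (j + 2 * int (Suc n))"
        using step[of "j + 2 * int n"] True by (simp add: algebra_simps)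
    qed auto
  next
    case False
    show ?thesis
    proof (rule finite_support_shift_zero[OF finp, of "-2"])
      fix n
      show "p (j + - 2 * int n) = p (j + - 2 * int (Suc n))"
        using step[of "j - 2 * int n - 2"] False by (simp add: algebra_simps)
    qed auto
  qed
  have "q 1 = 0" using rel(2)[of 0] p0 by simp
  moreover have "q 0 = 0" using rel(1)[of "-2"] p0 by simp
  ultimately show "M = 0"
    using D0[of "-1"] p0 by (simp add: D_def)
qed

section \<open>A triangle seen across a horizontal line\<close>

definition cross :: "complex \<Rightarrow> complex \<Rightarrow> real" where
  "cross v w = Re v * Im w - Im v * Re w"

definition ccw :: "complex \<Rightarrow> complex \<Rightarrow> complex \<Rightarrow> bool" where
  "ccw X Y Z \<longleftrightarrow> 0 < cross (Y - X) (Z - X)"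

text \<open>Up to the factor \<open>dist X Y\<close>, this is the signed distance of \<open>z\<close> from the line \<open>XY\<close>, positive on
  the left.\<close>

definition side :: "complex \<Rightarrow> complex \<Rightarrow> complex \<Rightarrow> real" where
  "side X Y z = cross (Y - X) (z - X)"

lemma ccw_rotate: "ccw X Y Z \<longleftrightarrow> ccw Y Z X"
  by (simp add: ccw_def cross_def algebra_simps)

lemma side_sum: "side X Y z + side Y Z z + side Z X z = cross (Y - X) (Z - X)"
  by (simp add: side_def cross_def algebra_simps)

lemma side_combination:
  assumes "u + v + w = 1"
  shows "side X Y (u *\<^sub>R X + v *\<^sub>R Y + w *\<^sub>R Z) = w * cross (Y - X) (Z - X)"
proof -
  have u: "u = 1 - v - w" using assms by simp
  show ?thesis
    unfolding u by (simp add: side_def cross_def algebra_simps)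
qed

text \<open>The barycentric coordinates of a point are its three \<open>side\<close> values divided by twice the area.\<close>

lemma ccw_triangle_eq:
  assumes "ccw X Y Z"
  shows "convex hull {X, Y, Z} = {z. 0 \<le> side X Y z \<and> 0 \<le> side Y Z z \<and> 0 \<le> side Z X z}"
    (is "_ = ?H")
proof
  let ?d = "cross (Y - X) (Z - X)"
  have d: "?d > 0" using assms by (simp add: ccw_def)
  have d2: "cross (Z - Y) (X - Y) = ?d" "cross (X - Z) (Y - Z) = ?d"
    by (simp_all add: cross_def algebra_simps)
  show "convex hull {X, Y, Z} \<subseteq> ?H"
  proof
    fix z assume "z \<in> convex hull {X, Y, Z}"
    then obtain u v w where uvw: "0 \<le> u" "0 \<le> v" "0 \<le> w" "u + v + w = 1"
      and z: "z = u *\<^sub>R X + v *\<^sub>R Y + w *\<^sub>R Z"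
      by (auto simp: convex_hull_3)
    have "side X Y z = w * ?d"
      using side_combination[OF uvw(4)] z by simp
    moreover have "side Y Z z = u * ?d"
      using side_combination[of v w u Y Z X] uvw(4) d2 z by (simp add: ac_simps)
    moreover have "side Z X z = v * ?d"
      using side_combination[of w u v Z X Y] uvw(4) d2 z by (simp add: ac_simps)
    ultimately show "z \<in> ?H"
      using uvw d by simp
  qed
  show "?H \<subseteq> convex hull {X, Y, Z}"
  proof
    fix z assume z: "z \<in> ?H"
    define u v w where "u = side Y Z z / ?d" and "v = side Z X z / ?d" and "w = side X Y z / ?d"
    have "u + v + w = 1"
      using side_sum[of X Y z Z] d by (simp add: u_def v_def w_def field_simps)
    moreover have "0 \<le> u" "0 \<le> v" "0 \<le> w"
      using z d by (auto simp: u_def v_def w_def)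
    moreover have "z = u *\<^sub>R X + v *\<^sub>R Y + w *\<^sub>R Z"
    proof -
      have "?d *\<^sub>R z = side Y Z z *\<^sub>R X + side Z X z *\<^sub>R Y + side X Y z *\<^sub>R Z"
        by (simp add: complex_eq_iff side_def cross_def algebra_simps)
      then have "z = (1 / ?d) *\<^sub>R (side Y Z z *\<^sub>R X + side Z X z *\<^sub>R Y + side X Y z *\<^sub>R Z)"
        using d by (metis divide_self_if less_irrefl scaleR_one scaleR_scaleR times_divide_eq_left mult_1)
      then show ?thesis
        by (simp add: u_def v_def w_def scaleR_add_right)
    qed
    ultimately show "z \<in> convex hull {X, Y, Z}"
      unfolding convex_hull_3 by blast
  qed
qed

text \<open>The contribution of the directed edge \<open>XY\<close> to the line \<open>Im z = s\<close> at abscissa \<open>r\<close>. An edge of an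
  anticlockwise triangle that runs to the right has the triangle above it and counts 1; one that runs
  to the left has it below and counts -1.\<close>

definition horizontal_edge :: "real \<Rightarrow> complex \<Rightarrow> complex \<Rightarrow> real \<Rightarrow> real" where
  "horizontal_edge s X Y r =
     (if Im X = s \<and> Im Y = s
      then indicat_real {Re X<..<Re Y} r - indicat_real {Re Y<..<Re X} r else 0)"

lemma sgn_eqD:
  fixes a b :: real
  assumes "sgn a = sgn b" "b \<noteq> 0"
  shows "a \<noteq> 0 \<and> (0 \<le> a \<longleftrightarrow> 0 \<le> b)"
  using assms by (auto simp: sgn_if split: if_splits)

lemma eventually_side_sgn_off_line:
  assumes "side X Y (Complex r s) \<noteq> 0"
  shows "\<forall>\<^sub>F e in at_right 0. sgn (side X Y (Complex r (s + e))) = sgn (side X Y (Complex r s))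
            \<and> sgn (side X Y (Complex r (s - e))) = sgn (side X Y (Complex r s))"
proof -
  have 1: "((\<lambda>e. side X Y (Complex r (s + e))) \<longlongrightarrow> side X Y (Complex r (s + 0))) (at_right 0)"
    and 2: "((\<lambda>e. side X Y (Complex r (s - e))) \<longlongrightarrow> side X Y (Complex r (s - 0))) (at_right 0)"
    unfolding side_def cross_def complex.sel minus_complex.sel by (intro tendsto_intros)+
  show ?thesis
  proof (cases "side X Y (Complex r s) > 0")
    case True
    then have "\<forall>\<^sub>F e in at_right 0. 0 < side X Y (Complex r (s + e))"
      "\<forall>\<^sub>F e in at_right 0. 0 < side X Y (Complex r (s - e))"
      using order_tendstoD(1)[OF 1, of 0] order_tendstoD(1)[OF 2, of 0] by simp_all
    then show ?thesis
      by eventually_elim (use True in simp)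
  next
    case False
    then have neg: "side X Y (Complex r s) < 0" using assms by simp
    then have "\<forall>\<^sub>F e in at_right 0. side X Y (Complex r (s + e)) < 0"
      "\<forall>\<^sub>F e in at_right 0. side X Y (Complex r (s - e)) < 0"
      using order_tendstoD(2)[OF 1, of 0] order_tendstoD(2)[OF 2, of 0] by simp_all
    then show ?thesis
      by eventually_elim (use neg in simp)
  qed
qed

lemma finite_side_zero_on_line:
  assumes "X \<noteq> Y" and "\<not> (Im X = s \<and> Im Y = s)"
  shows "finite {r. side X Y (Complex r s) = 0}"
proof (cases "Im X = Im Y")
  case True
  then have "{r. side X Y (Complex r s) = 0} = {}"
    using assms by (auto simp: side_def cross_def complex_eq_iff)
  then show ?thesis by simp
next
  case False
  have "{r. side X Y (Complex r s) = 0} \<subseteq> {Re X + (Re Y - Re X) * (s - Im X) / (Im Y - Im X)}"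
    using False by (auto simp: side_def cross_def field_simps)
  then show ?thesis using finite_subset by blast
qed

text \<open>Near the point \<open>Complex r s\<close>, the edges on the line account for the difference of the indicator of
  the triangle just above and just below. The first conjunct records that the nearby points avoid the
  lines through the sides, hence the boundary of the triangle, so that in a tiling they lie in at most
  one tile.\<close>

definition jumps_at :: "real \<Rightarrow> complex \<Rightarrow> complex \<Rightarrow> complex \<Rightarrow> real \<Rightarrow> bool" where
  "jumps_at s X Y Z r \<longleftrightarrow> (\<forall>\<^sub>F e in at_right 0.
     (\<forall>z \<in> {Complex r (s + e), Complex r (s - e)}.
        side X Y z \<noteq> 0 \<and> side Y Z z \<noteq> 0 \<and> side Z X z \<noteq> 0) \<and>
     indicat_real (convex hull {X, Y, Z}) (Complex r (s + e))
       - indicat_real (convex hull {X, Y, Z}) (Complex r (s - e))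
     = horizontal_edge s X Y r + horizontal_edge s Y Z r + horizontal_edge s Z X r)"

lemma jumps_at_rotate: "jumps_at s X Y Z r \<longleftrightarrow> jumps_at s Y Z X r"
proof -
  have "{Y, Z, X} = {X, Y, Z}" by auto
  then show ?thesis
    unfolding jumps_at_def by (auto simp: ac_simps elim!: eventually_mono)
qed

lemma ccw_distinct: "ccw X Y Z \<Longrightarrow> X \<noteq> Y \<and> Y \<noteq> Z \<and> Z \<noteq> X"
  by (auto simp: ccw_def cross_def algebra_simps)

text \<open>A side line other than \<open>Im z = s\<close> meets it in at most one point. Elsewhere, being on one side of
  it does not change under small vertical moves, so the indicator has no jump.\<close>

lemma jumps_at_no_edge:
  assumes c: "ccw X Y Z"
    and "\<not> (Im X = s \<and> Im Y = s)" "\<not> (Im Y = s \<and> Im Z = s)" "\<not> (Im Z = s \<and> Im X = s)"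
  shows "\<exists>B. finite B \<and> (\<forall>r. r \<notin> B \<longrightarrow> jumps_at s X Y Z r)"
proof -
  let ?zs = "\<lambda>X Y. {r. side X Y (Complex r s) = 0}"
  have "finite (?zs X Y \<union> ?zs Y Z \<union> ?zs Z X)"
    using finite_side_zero_on_line[of X Y s] finite_side_zero_on_line[of Y Z s]
      finite_side_zero_on_line[of Z X s] ccw_distinct[OF c] assms by simp
  moreover have "jumps_at s X Y Z r" if "r \<notin> ?zs X Y \<union> ?zs Y Z \<union> ?zs Z X" for r
  proof -
    from that have nz: "side X Y (Complex r s) \<noteq> 0" "side Y Z (Complex r s) \<noteq> 0"
      "side Z X (Complex r s) \<noteq> 0" by auto
    show ?thesis
      unfolding jumps_at_def ccw_triangle_eq[OF c]
      using eventually_side_sgn_off_line[OF nz(1)] eventually_side_sgn_off_line[OF nz(2)]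
        eventually_side_sgn_off_line[OF nz(3)]
    proof eventually_elim
      case (elim e)
      have "horizontal_edge s X Y r = 0" "horizontal_edge s Y Z r = 0" "horizontal_edge s Z X r = 0"
        using assms by (auto simp: horizontal_edge_def)
      moreover note sgn_eqD[OF conjunct1[OF elim(1)] nz(1)] sgn_eqD[OF conjunct2[OF elim(1)] nz(1)]
        sgn_eqD[OF conjunct1[OF elim(2)] nz(2)] sgn_eqD[OF conjunct2[OF elim(2)] nz(2)]
        sgn_eqD[OF conjunct1[OF elim(3)] nz(3)] sgn_eqD[OF conjunct2[OF elim(3)] nz(3)]
      ultimately show ?case
        by (simp add: indicator_def)
    qed
  qed
  ultimately show ?thesis
    by (intro exI[of _ "?zs X Y \<union> ?zs Y Z \<union> ?zs Z X"]) simp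
qed

text \<open>If \<open>XY\<close> lies on the line, crossing the line changes only the sign of \<open>side X Y\<close>; the other two
  signs say whether \<open>r\<close> is strictly between the endpoints.\<close>

lemma jumps_at_edge:
  assumes c: "ccw X Y Z" and XY: "Im X = s" "Im Y = s"
  shows "\<exists>B. finite B \<and> (\<forall>r. r \<notin> B \<longrightarrow> jumps_at s X Y Z r)"
proof -
  have Z: "(Re Y - Re X) * (Im Z - s) > 0"
    using c XY by (simp add: ccw_def cross_def)
  have sYZ: "side Y Z (Complex r s) = (Im Z - s) * (Re Y - r)" for r
    by (simp add: side_def cross_def XY algebra_simps)
  have sZX: "side Z X (Complex r s) = (Im Z - s) * (r - Re X)" for r
    by (simp add: side_def cross_def XY algebra_simps)
  have "jumps_at s X Y Z r" if r: "r \<notin> {Re X, Re Y}" for r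
  proof -
    have nz: "side Y Z (Complex r s) \<noteq> 0" "side Z X (Complex r s) \<noteq> 0"
      using Z r by (auto simp: sYZ sZX)
    have pos: "\<forall>\<^sub>F e in at_right (0::real). e > 0"
      by (simp add: eventually_at_right_less)
    show ?thesis
      unfolding jumps_at_def ccw_triangle_eq[OF c]
      using eventually_side_sgn_off_line[OF nz(1)] eventually_side_sgn_off_line[OF nz(2)] pos
    proof eventually_elim
      case (elim e)
      have h0: "horizontal_edge s Y Z r = 0" "horizontal_edge s Z X r = 0"
        using Z by (auto simp: horizontal_edge_def)
      have up: "side X Y (Complex r (s + e)) = (Re Y - Re X) * e"
        and dn: "side X Y (Complex r (s - e)) = - ((Re Y - Re X) * e)"
        by (simp_all add: side_def cross_def XY)
      have XY0: "side X Y (Complex r (s + e)) \<noteq> 0" "side X Y (Complex r (s - e)) \<noteq> 0"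
        using elim(3) Z unfolding up dn by auto
      note YZ = sgn_eqD[OF conjunct1[OF elim(1)] nz(1)] sgn_eqD[OF conjunct2[OF elim(1)] nz(1)]
      note ZX = sgn_eqD[OF conjunct1[OF elim(2)] nz(2)] sgn_eqD[OF conjunct2[OF elim(2)] nz(2)]
      have up': "indicat_real {z. 0 \<le> side X Y z \<and> 0 \<le> side Y Z z \<and> 0 \<le> side Z X z} (Complex r (s + e))
          = of_bool (Re X < r \<and> r < Re Y)"
      proof (cases "Re X < Re Y")
        case True
        then have "Im Z - s > 0" using Z by (simp add: zero_less_mult_iff)
        with True show ?thesis
          using elim(3) r YZ ZX
          by (auto simp: up sYZ sZX indicator_def zero_le_mult_iff)
      next
        case False
        then have "Re Y < Re X" using Z by (cases "Re X = Re Y") auto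
        then show ?thesis
          using elim(3) by (auto simp: up indicator_def zero_le_mult_iff)
      qed
      have dn': "indicat_real {z. 0 \<le> side X Y z \<and> 0 \<le> side Y Z z \<and> 0 \<le> side Z X z} (Complex r (s - e))
          = of_bool (Re Y < r \<and> r < Re X)"
      proof (cases "Re X < Re Y")
        case True
        then show ?thesis
          using elim(3) by (auto simp: dn indicator_def mult_le_0_iff)
      next
        case False
        then have "Re Y < Re X" using Z by (cases "Re X = Re Y") auto
        moreover from this have "Im Z - s < 0" using Z by (simp add: zero_less_mult_iff)
        ultimately show ?thesis
          using elim(3) r YZ ZX
          by (auto simp: dn sYZ sZX indicator_def zero_le_mult_iff mult_le_0_iff)
      qed
      show ?case
        unfolding up' dn' h0 using XY0 YZ ZX XY by (simp add: horizontal_edge_def indicator_def)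
    qed
  qed
  then show ?thesis by (intro exI[of _ "{Re X, Re Y}"]) auto
qed

lemma jumps_at_cofinite:
  assumes c: "ccw X Y Z"
  shows "\<exists>B. finite B \<and> (\<forall>r. r \<notin> B \<longrightarrow> jumps_at s X Y Z r)"
proof -
  consider "Im X = s \<and> Im Y = s" | "Im Y = s \<and> Im Z = s" | "Im Z = s \<and> Im X = s"
    | "\<not> (Im X = s \<and> Im Y = s)" "\<not> (Im Y = s \<and> Im Z = s)" "\<not> (Im Z = s \<and> Im X = s)"
    by blast
  then show ?thesis
  proof cases
    case 1 then show ?thesis using jumps_at_edge[OF c] by auto
  next
    case 2
    then show ?thesis
      using jumps_at_edge[of Y Z X s] c
      unfolding ccw_rotate[of X Y Z] jumps_at_rotate[of s X Y Z] by blast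
  next
    case 3
    then show ?thesis
      using jumps_at_edge[of Z X Y s] c
      unfolding ccw_rotate[of Z X Y, symmetric] jumps_at_rotate[of s Z X Y, symmetric] by blast
  next
    case 4 then show ?thesis using jumps_at_no_edge[OF c] by auto
  qed
qed

section \<open>Additivity of directed boundary length\<close>

definition horizontal_length :: "complex \<Rightarrow> real" where
  "horizontal_length v = (if Im v = 0 then Re v else 0)"

definition horizontal_boundary :: "complex \<Rightarrow> complex \<Rightarrow> complex \<Rightarrow> real" where
  "horizontal_boundary X Y Z =
     horizontal_length (Y - X) + horizontal_length (Z - Y) + horizontal_length (X - Z)"

lemma has_integral_horizontal_edge:
  "(horizontal_edge s X Y has_integral (if Im X = s then horizontal_length (Y - X) else 0)) UNIV"
proof (cases "Im X = s \<and> Im Y = s")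
  case True
  have ind: "((\<lambda>r. indicat_real {a<..<b} r) has_integral (if a \<le> b then b - a else 0)) UNIV" for a b :: real
  proof -
    have "((\<lambda>r. 1::real) has_integral (if a \<le> b then b - a else 0)) {a<..<b}"
      unfolding has_integral_Icc_iff_Ioo[symmetric] using has_integral_const_real[of "1::real" a b]
      by auto
    then have "((\<lambda>r. if r \<in> {a<..<b} then 1::real else 0) has_integral (if a \<le> b then b - a else 0)) UNIV"
      by (subst has_integral_restrict_UNIV)
    then show ?thesis
      by (simp only: indicator_def of_bool_def)
  qed
  have "horizontal_edge s X Y = (\<lambda>r. indicat_real {Re X<..<Re Y} r - indicat_real {Re Y<..<Re X} r)"
    using True by (auto simp: horizontal_edge_def)
  moreover have "horizontal_length (Y - X) =
      (if Re X \<le> Re Y then Re Y - Re X else 0) - (if Re Y \<le> Re X then Re X - Re Y else 0)"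
    using True by (auto simp: horizontal_length_def)
  ultimately show ?thesis
    using has_integral_diff[OF ind ind] True by simp
next
  case False
  then have "horizontal_edge s X Y = (\<lambda>r. 0)"
    by (auto simp: horizontal_edge_def)
  moreover have "Im X = s \<longrightarrow> horizontal_length (Y - X) = 0"
    using False by (simp add: horizontal_length_def)
  ultimately show ?thesis by simp
qed

lemma side_continuous: "continuous_on UNIV (side X Y)"
  unfolding side_def cross_def by (intro continuous_intros)

lemma interior_ccw_triangle:
  assumes c: "ccw X Y Z" and z: "z \<in> convex hull {X, Y, Z}"
    and nz: "side X Y z \<noteq> 0" "side Y Z z \<noteq> 0" "side Z X z \<noteq> 0"
  shows "z \<in> interior (convex hull {X, Y, Z})"
proof (rule interiorI)
  let ?O = "{z. 0 < side X Y z \<and> 0 < side Y Z z \<and> 0 < side Z X z}"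
  show "open ?O"
    by (intro open_Collect_conj open_Collect_less continuous_on_const side_continuous)
  show "z \<in> ?O" using z nz unfolding ccw_triangle_eq[OF c] by auto
  show "?O \<subseteq> convex hull {X, Y, Z}" unfolding ccw_triangle_eq[OF c] by auto
qed

text \<open>A point off all side lines that lies in a tile lies in its interior, and the interiors are
  disjoint.\<close>

lemma sum_indicator_tiling:
  assumes fin: "finite I"
    and c: "\<And>i. i \<in> I \<Longrightarrow> ccw (X i) (Y i) (Z i)"
    and cover: "(\<Union>i\<in>I. convex hull {X i, Y i, Z i}) = S"
    and disj: "\<And>i j. i \<in> I \<Longrightarrow> j \<in> I \<Longrightarrow> i \<noteq> j \<Longrightarrow>
        interior (convex hull {X i, Y i, Z i}) \<inter> interior (convex hull {X j, Y j, Z j}) = {}"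
    and nz: "\<And>i. i \<in> I \<Longrightarrow> side (X i) (Y i) z \<noteq> 0 \<and> side (Y i) (Z i) z \<noteq> 0 \<and> side (Z i) (X i) z \<noteq> 0"
  shows "(\<Sum>i\<in>I. indicat_real (convex hull {X i, Y i, Z i}) z) = indicat_real S z"
proof (cases "z \<in> S")
  case True
  then obtain i where i: "i \<in> I" "z \<in> convex hull {X i, Y i, Z i}"
    using cover by auto
  have "indicat_real (convex hull {X j, Y j, Z j}) z = of_bool (j = i)" if "j \<in> I" for j
    using that i disj[of i j] interior_ccw_triangle[OF c] nz by (auto simp: indicator_def)
  then have "(\<Sum>j\<in>I. indicat_real (convex hull {X j, Y j, Z j}) z) = (\<Sum>j\<in>I. of_bool (j = i))"
    by simp
  also have "\<dots> = 1" using fin i by (simp add: of_bool_def)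
  finally show ?thesis using True by simp
next
  case False
  then show ?thesis using cover by (auto intro!: sum.neutral simp: indicator_def)
qed

text \<open>Off the side lines the indicators of the tiles add up to that of the tiled triangle. Taking the
  difference across the line turns this into an identity between edges on the line, valid away from
  finitely many points.\<close>

lemma horizontal_edges_on_line_eq:
  fixes s :: real
  assumes fin: "finite I"
    and c: "\<And>i. i \<in> I \<Longrightarrow> ccw (X i) (Y i) (Z i)" and cS: "ccw A B C"
    and cover: "(\<Union>i\<in>I. convex hull {X i, Y i, Z i}) = convex hull {A, B, C}"
    and disj: "\<And>i j. i \<in> I \<Longrightarrow> j \<in> I \<Longrightarrow> i \<noteq> j \<Longrightarrow>
        interior (convex hull {X i, Y i, Z i}) \<inter> interior (convex hull {X j, Y j, Z j}) = {}"
  defines "h \<equiv> \<lambda>X Y Z r. horizontal_edge s X Y r + horizontal_edge s Y Z r + horizontal_edge s Z X r"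
  shows "\<exists>E. finite E \<and> (\<forall>r. r \<notin> E \<longrightarrow> (\<Sum>i\<in>I. h (X i) (Y i) (Z i) r) = h A B C r)"
proof -
  have "\<forall>i\<in>I. \<exists>E. finite E \<and> (\<forall>r. r \<notin> E \<longrightarrow> jumps_at s (X i) (Y i) (Z i) r)"
    using jumps_at_cofinite c by blast
  then obtain E where E: "\<And>i. i \<in> I \<Longrightarrow> finite (E i)"
      "\<And>i r. i \<in> I \<Longrightarrow> r \<notin> E i \<Longrightarrow> jumps_at s (X i) (Y i) (Z i) r"
    by metis
  obtain E0 where E0: "finite E0" "\<And>r. r \<notin> E0 \<Longrightarrow> jumps_at s A B C r"
    using jumps_at_cofinite[OF cS] by blast
  have "(\<Sum>i\<in>I. h (X i) (Y i) (Z i) r) = h A B C r" if r: "r \<notin> E0 \<union> (\<Union>i\<in>I. E i)" for r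
  proof -
    have "\<forall>i\<in>I. jumps_at s (X i) (Y i) (Z i) r"
      using r E by auto
    then have ev: "\<forall>\<^sub>F e in at_right 0. \<forall>i\<in>I.
       (\<forall>z \<in> {Complex r (s + e), Complex r (s - e)}.
        side (X i) (Y i) z \<noteq> 0 \<and> side (Y i) (Z i) z \<noteq> 0 \<and> side (Z i) (X i) z \<noteq> 0) \<and>
        indicat_real (convex hull {X i, Y i, Z i}) (Complex r (s + e))
        - indicat_real (convex hull {X i, Y i, Z i}) (Complex r (s - e)) = h (X i) (Y i) (Z i) r"
      unfolding jumps_at_def h_def by (intro eventually_ball_finite fin)
    have ev0: "\<forall>\<^sub>F e in at_right 0. indicat_real (convex hull {A, B, C}) (Complex r (s + e))
        - indicat_real (convex hull {A, B, C}) (Complex r (s - e)) = h A B C r"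
      using E0(2)[of r] r unfolding jumps_at_def h_def by (auto elim!: eventually_mono)
    have "\<forall>\<^sub>F e in at_right (0::real). (\<Sum>i\<in>I. h (X i) (Y i) (Z i) r) = h A B C r"
      using ev ev0
    proof eventually_elim
      case (elim e)
      have "(\<Sum>i\<in>I. h (X i) (Y i) (Z i) r) =
         (\<Sum>i\<in>I. indicat_real (convex hull {X i, Y i, Z i}) (Complex r (s + e))
                - indicat_real (convex hull {X i, Y i, Z i}) (Complex r (s - e)))"
        using elim(1) by simp
      also have "\<dots> = indicat_real (convex hull {A, B, C}) (Complex r (s + e))
                - indicat_real (convex hull {A, B, C}) (Complex r (s - e))"
        unfolding sum_subtractf
        using sum_indicator_tiling[OF fin c cover disj, of "Complex r (s + e)"]
          sum_indicator_tiling[OF fin c cover disj, of "Complex r (s - e)"] elim(1) by simp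
      finally show ?case using elim(2) by simp
    qed
    then show ?thesis
      using eventually_happens' trivial_limit_at_right_real by blast
  qed
  moreover have "finite (E0 \<union> (\<Union>i\<in>I. E i))"
    using E E0 fin by auto
  ultimately show ?thesis by (intro exI[of _ "E0 \<union> (\<Union>i\<in>I. E i)"]) simp
qed

text \<open>Integrating the preceding identity over each horizontal line turns indicators of edges into their
  lengths; only the finitely many lines through vertices contribute.\<close>

theorem horizontal_boundary_additive:
  assumes fin: "finite I"
    and c: "\<And>i. i \<in> I \<Longrightarrow> ccw (X i) (Y i) (Z i)" and cS: "ccw A B C"
    and cover: "(\<Union>i\<in>I. convex hull {X i, Y i, Z i}) = convex hull {A, B, C}"
    and disj: "\<And>i j. i \<in> I \<Longrightarrow> j \<in> I \<Longrightarrow> i \<noteq> j \<Longrightarrow>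
        interior (convex hull {X i, Y i, Z i}) \<inter> interior (convex hull {X j, Y j, Z j}) = {}"
  shows "(\<Sum>i\<in>I. horizontal_boundary (X i) (Y i) (Z i)) = horizontal_boundary A B C"
proof -
  define L where "L s X Y = (if Im X = s then horizontal_length (Y - X) else 0)"
    for s X Y
  define l where "l s X Y Z = L s X Y + L s Y Z + L s Z X" for s X Y Z
  define h where "h s X Y Z r = horizontal_edge s X Y r + horizontal_edge s Y Z r + horizontal_edge s Z X r"
    for s X Y Z r
  have int: "(h s X Y Z has_integral l s X Y Z) UNIV" for s X Y Z
    unfolding h_def l_def L_def by (intro has_integral_add has_integral_horizontal_edge)
  have line: "(\<Sum>i\<in>I. l s (X i) (Y i) (Z i)) = l s A B C" for s
  proof -
    obtain E where E: "finite E" "\<And>r. r \<notin> E \<Longrightarrow> (\<Sum>i\<in>I. h s (X i) (Y i) (Z i) r) = h s A B C r"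
      using horizontal_edges_on_line_eq[OF fin c cS cover disj, of s] unfolding h_def by blast
    have "((\<lambda>r. \<Sum>i\<in>I. h s (X i) (Y i) (Z i) r) has_integral (\<Sum>i\<in>I. l s (X i) (Y i) (Z i))) UNIV"
      by (intro has_integral_sum fin int)
    then have "(h s A B C has_integral (\<Sum>i\<in>I. l s (X i) (Y i) (Z i))) UNIV"
      by (rule has_integral_spike_finite[OF E(1), rotated]) (use E(2) in auto)
    then show ?thesis
      using int has_integral_unique by blast
  qed
  \<comment> \<open>The heights of all vertices, so that every horizontal edge lies on exactly one of these lines.\<close>
  define F where "F = insert (Im A) (insert (Im B) (insert (Im C)
      ((\<lambda>i. Im (X i)) ` I \<union> (\<lambda>i. Im (Y i)) ` I \<union> (\<lambda>i. Im (Z i)) ` I)))"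
  have finF: "finite F" using fin by (simp add: F_def)
  have Lsum: "(\<Sum>s\<in>F. L s X Y) = horizontal_length (Y - X)" if "Im X \<in> F" for X Y
    using finF that by (simp add: L_def)
  have lsum: "(\<Sum>s\<in>F. l s X Y Z) = horizontal_boundary X Y Z"
    if "Im X \<in> F" "Im Y \<in> F" "Im Z \<in> F" for X Y Z
    using that by (simp add: l_def sum.distrib Lsum horizontal_boundary_def)
  have "(\<Sum>i\<in>I. horizontal_boundary (X i) (Y i) (Z i)) = (\<Sum>i\<in>I. \<Sum>s\<in>F. l s (X i) (Y i) (Z i))"
    by (intro sum.cong refl lsum[symmetric]) (auto simp: F_def)
  also have "\<dots> = (\<Sum>s\<in>F. l s A B C)"
    by (subst sum.swap) (simp add: line)
  also have "\<dots> = horizontal_boundary A B C"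
    by (rule lsum) (auto simp: F_def)
  finally show ?thesis .
qed

definition cpx :: "real^2 \<Rightarrow> complex" where
  "cpx v = Complex (v $ 1) (v $ 2)"

lemma linear_cpx_div: "linear (\<lambda>v. cpx v / u)"
  unfolding divide_inverse
proof (intro linearI)
  fix v w :: "real^2" and c :: real
  have "cpx (v + w) = cpx v + cpx w" "cpx (c *\<^sub>R v) = c *\<^sub>R cpx v"
    by (simp_all add: cpx_def complex_eq_iff)
  then show "cpx (v + w) * inverse u = cpx v * inverse u + cpx w * inverse u"
    "cpx (c *\<^sub>R v) * inverse u = c *\<^sub>R (cpx v * inverse u)"
    by (simp_all add: distrib_right)
qed

lemma cpx_diff: "cpx (v - w) = cpx v - cpx w"
  by (simp add: cpx_def complex_eq_iff)

lemma cpx_eq_iff: "cpx v = cpx w \<longleftrightarrow> v = w"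
  by (simp add: cpx_def vec_eq_iff forall_2)

lemma norm_cpx: "norm (cpx v) = norm v"
  by (simp add: cpx_def norm_complex_def norm_vec_def L2_set_def sum_2)

lemma inner_cpx: "cpx v \<bullet> cpx w = v \<bullet> w"
  by (simp add: cpx_def inner_complex_def inner_vec_def sum_2)

lemma cross_divide: 
  assumes "norm u = 1" shows "cross (v / u) (w / u) = cross v w"
proof -
  have cr: "cross v w = Im (cnj v * w)" for v w by (simp add: cross_def)
  have "cnj (v / u) * (w / u) = cnj v * w / (u * cnj u)" by simp
  also have "u * cnj u = 1" using assms by (metis complex_norm_square of_real_1 one_power2)
  finally show ?thesis by (simp add: cr)
qed

definition directed_boundary :: "complex \<Rightarrow> complex \<Rightarrow> complex \<Rightarrow> complex \<Rightarrow> real" where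
  "directed_boundary u X Y Z = horizontal_length ((Y - X) / u) + horizontal_length ((Z - Y) / u)
     + horizontal_length ((X - Z) / u)"

text \<open>Additivity in an arbitrary direction \<open>u\<close> reduces to the horizontal one by the rotation that takes
  \<open>u\<close> to 1.\<close>

theorem directed_boundary_additive:
  fixes X Y Z :: "'i \<Rightarrow> real^2" and A B C :: "real^2"
  assumes u: "norm u = 1" and fin: "finite I"
    and c: "\<And>i. i \<in> I \<Longrightarrow> ccw (cpx (X i)) (cpx (Y i)) (cpx (Z i))"
    and cS: "ccw (cpx A) (cpx B) (cpx C)"
    and cover: "(\<Union>i\<in>I. convex hull {X i, Y i, Z i}) = convex hull {A, B, C}"
    and disj: "\<And>i j. i \<in> I \<Longrightarrow> j \<in> I \<Longrightarrow> i \<noteq> j \<Longrightarrow>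
        interior (convex hull {X i, Y i, Z i}) \<inter> interior (convex hull {X j, Y j, Z j}) = {}"
  shows "(\<Sum>i\<in>I. directed_boundary u (cpx (X i)) (cpx (Y i)) (cpx (Z i)))
       = directed_boundary u (cpx A) (cpx B) (cpx C)"
proof -
  define f where "f v = cpx v / u" for v
  have u0: "u \<noteq> 0" using u by auto
  have lin: "linear f" unfolding f_def by (rule linear_cpx_div)
  have inj: "inj f"
    using u0 by (auto simp: inj_def f_def cpx_eq_iff)
  have cont: "continuous_on UNIV f"
    using lin by (simp add: linear_continuous_on linear_conv_bounded_linear)
  have hull: "convex hull {f P, f Q, f R} = f ` (convex hull {P, Q, R})" for P Q R
    using convex_hull_linear_image[OF lin, of "{P, Q, R}"] by simp
  have intf: "v \<in> interior S" if "f v \<in> interior (f ` S)" for v S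
  proof (rule interiorI)
    show "open (f -` interior (f ` S))"
      using cont by (simp add: open_vimage)
    show "v \<in> f -` interior (f ` S)" using that by simp
    show "f -` interior (f ` S) \<subseteq> S"
      using interior_subset[of "f ` S"] inj by (auto dest: injD)
  qed
  have intS: "interior (f ` S) \<inter> interior (f ` T) = {}" if "interior S \<inter> interior T = {}" for S T
    using intf interior_subset[of "f ` S"] that by fastforce
  have ccwf: "ccw (f P) (f Q) (f R) \<longleftrightarrow> ccw (cpx P) (cpx Q) (cpx R)" for P Q R
    by (simp add: ccw_def f_def cross_divide[OF u] flip: diff_divide_distrib)
  have hb: "horizontal_boundary (f P) (f Q) (f R) = directed_boundary u (cpx P) (cpx Q) (cpx R)" for P Q R
    by (simp add: horizontal_boundary_def directed_boundary_def f_def flip: diff_divide_distrib)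
  have "(\<Sum>i\<in>I. horizontal_boundary (f (X i)) (f (Y i)) (f (Z i))) = horizontal_boundary (f A) (f B) (f C)"
  proof (rule horizontal_boundary_additive[OF fin])
    show "(\<Union>i\<in>I. convex hull {f (X i), f (Y i), f (Z i)}) = convex hull {f A, f B, f C}"
      unfolding hull cover[symmetric] by blast
    show "interior (convex hull {f (X i), f (Y i), f (Z i)}) \<inter>
          interior (convex hull {f (X j), f (Y j), f (Z j)}) = {}"
      if "i \<in> I" "j \<in> I" "i \<noteq> j" for i j
      unfolding hull using disj[OF that] by (rule intS)
  qed (use c cS ccwf in auto)
  then show ?thesis by (simp add: hb)
qed

section \<open>Edge directions in powers of a rotation\<close>

text \<open>This is where irrationality of \<alpha>/\<pi> enters: it makes the directions for different exponents
  distinct, even up to sign, so that the boundary equations can be compared exponent by exponent.\<close>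

lemma powi_cis_eq_pm_1D:
  assumes irr: "\<not> (\<exists>q\<in>\<rat>. \<alpha> = q * pi)" and z: "cis \<alpha> powi k = 1 \<or> cis \<alpha> powi k = -1"
  shows "k = 0"
proof (rule ccontr)
  assume k: "k \<noteq> 0"
  have "cis (real_of_int k * \<alpha>) = 1 \<or> cis (real_of_int k * \<alpha>) = -1"
    using z by (simp add: cis_power_int)
  then have "sin (real_of_int k * \<alpha>) = 0"
    by (auto simp: complex_eq_iff)
  then obtain n :: int where "real_of_int k * \<alpha> = real_of_int n * pi"
    by (auto simp: sin_zero_iff_int2)
  then have "\<alpha> = (real_of_int n / real_of_int k) * pi"
    using k by (simp add: field_simps)
  then show False using irr by (metis Rats_divide Rats_of_int)
qed

definition unit_sign :: "complex \<Rightarrow> int" where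
  "unit_sign z = (if z = 1 then 1 else if z = -1 then -1 else 0)"

lemma unit_sign_minus: "unit_sign (- z) = - unit_sign z"
proof -
  have "- z = 1 \<longleftrightarrow> z = -1" "- z = -1 \<longleftrightarrow> z = 1"
    by (metis minus_minus)+
  then show ?thesis unfolding unit_sign_def by simp
qed

text \<open>Whether the unit vector \<open>w\<close> points along (1), against (-1) or off (0) the \<open>k\<close>-th direction
  \<open>cis \<alpha> powi k * u\<close>.\<close>

definition dir_sign :: "real \<Rightarrow> complex \<Rightarrow> complex \<Rightarrow> int \<Rightarrow> int" where
  "dir_sign \<alpha> u w k = unit_sign (w / (cis \<alpha> powi k * u))"

lemma dir_sign_shift:
  assumes "u \<noteq> 0"
  shows "dir_sign \<alpha> u (cis \<alpha> powi j * w) k = dir_sign \<alpha> u w (k - j)"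
proof -
  have "cis \<alpha> powi k = cis \<alpha> powi j * cis \<alpha> powi (k - j)"
    by (simp flip: power_int_add)
  then have "(cis \<alpha> powi j * w) / (cis \<alpha> powi k * u) = w / (cis \<alpha> powi (k - j) * u)"
    by simp
  then show ?thesis by (simp add: dir_sign_def)
qed

lemma dir_sign_self:
  assumes irr: "\<not> (\<exists>q\<in>\<rat>. \<alpha> = q * pi)" and "u \<noteq> 0"
  shows "dir_sign \<alpha> u u k = of_bool (k = 0)"
proof -
  have "u / (cis \<alpha> powi k * u) = cis \<alpha> powi (- k)"
    using \<open>u \<noteq> 0\<close> by (simp add: power_int_minus field_simps)
  then show ?thesis
    using powi_cis_eq_pm_1D[OF irr, of "- k"] by (auto simp: dir_sign_def unit_sign_def)
qed

lemma finite_dir_sign_support: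
  assumes irr: "\<not> (\<exists>q\<in>\<rat>. \<alpha> = q * pi)" and "u \<noteq> 0"
  shows "finite {k. dir_sign \<alpha> u w k \<noteq> 0}"
proof (cases "\<exists>j. dir_sign \<alpha> u w j \<noteq> 0")
  case True
  then obtain j where "dir_sign \<alpha> u w j \<noteq> 0" by blast
  then have "w / (cis \<alpha> powi j * u) = 1 \<or> w / (cis \<alpha> powi j * u) = -1"
    by (auto simp: dir_sign_def unit_sign_def split: if_splits)
  moreover have "w = w / (cis \<alpha> powi j * u) * (cis \<alpha> powi j * u)"
    using \<open>u \<noteq> 0\<close> by simp
  ultimately have j: "w = cis \<alpha> powi j * u \<or> w = - (cis \<alpha> powi j * u)"
    by (metis mult_1 mult_minus1)
  have neg: "dir_sign \<alpha> u (- v) k = - dir_sign \<alpha> u v k" for v k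
    unfolding dir_sign_def by (simp add: unit_sign_minus)
  have "dir_sign \<alpha> u (cis \<alpha> powi j * u) k = of_bool (k = j)" for k
    using dir_sign_shift[OF \<open>u \<noteq> 0\<close>] dir_sign_self[OF irr \<open>u \<noteq> 0\<close>] by simp
  then have "dir_sign \<alpha> u w k = 0" if "k \<noteq> j" for k
    using j neg that by (metis neg_equal_0_iff_equal of_bool_eq_0_iff)
  then have "{k. dir_sign \<alpha> u w k \<noteq> 0} \<subseteq> {j}" by blast
  then show ?thesis by (rule finite_subset) simp
qed auto

lemma horizontal_length_dir_sign:
  fixes t :: real
  assumes "norm u = 1" "norm w = 1"
  shows "horizontal_length (t *\<^sub>R w / (cis \<alpha> powi k * u)) = t * dir_sign \<alpha> u w k"
proof -
  define z where "z = w / (cis \<alpha> powi k * u)"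
  have "norm z = 1"
    using assms by (simp add: z_def norm_divide norm_mult norm_power_int)
  then have z: "(Re z)\<^sup>2 + (Im z)\<^sup>2 = 1"
    by (metis cmod_power2 one_power2)
  have "horizontal_length (t *\<^sub>R z) = t * unit_sign z"
    using z by (auto simp: horizontal_length_def unit_sign_def complex_eq_iff power2_eq_1_iff)
  moreover have "t *\<^sub>R w / (cis \<alpha> powi k * u) = t *\<^sub>R z"
    by (simp add: z_def scaleR_conv_of_real)
  ultimately show ?thesis
    unfolding dir_sign_def z_def[symmetric] by metis
qed

section \<open>The sides of the tile and of the isosceles triangle\<close>

text \<open>The complex number \<open>cnj v * w\<close> has real part \<open>v \<bullet> w\<close> and imaginary part \<open>cross v w\<close>.\<close>

lemma rotate_by_angle:
  assumes "norm v = c" "norm w = b" "c > 0" "b > 0"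
    and "v \<bullet> w = b * c * cos \<alpha>" "cross v w > 0" "sin \<alpha> > 0"
  shows "w = (b / c) *\<^sub>R (cis \<alpha> * v)"
proof -
  have "(cross v w)\<^sup>2 + (v \<bullet> w)\<^sup>2 = (norm v)\<^sup>2 * (norm w)\<^sup>2"
    unfolding cmod_power2 cross_def inner_complex_def by (simp add: power2_eq_square algebra_simps)
  then have "(cross v w)\<^sup>2 = (b * c)\<^sup>2 * (1 - (cos \<alpha>)\<^sup>2)"
    using assms by (simp add: power_mult_distrib algebra_simps)
  also have "\<dots> = (b * c * sin \<alpha>)\<^sup>2"
    by (simp add: sin_squared_eq power_mult_distrib)
  finally have "(cross v w)\<^sup>2 = (b * c * sin \<alpha>)\<^sup>2" .
  then have cr: "cross v w = b * c * sin \<alpha>"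
    by (rule power2_eq_imp_eq) (use \<open>c > 0\<close> \<open>b > 0\<close> \<open>cross v w > 0\<close> \<open>sin \<alpha> > 0\<close> in simp_all)
  have "cnj v * w = of_real (b * c) * cis \<alpha>"
    using cr assms(5) by (simp add: complex_eq_iff cross_def inner_complex_def)
  then have "v * cnj v * w = of_real (b * c) * cis \<alpha> * v"
    by (simp add: mult_ac)
  moreover have "v * cnj v = of_real (c\<^sup>2)"
    using assms(1) by (metis complex_norm_square)
  ultimately have "of_real (c\<^sup>2) * w = of_real (b * c) * cis \<alpha> * v"
    by simp
  then show ?thesis
    using \<open>c > 0\<close> by (simp add: scaleR_conv_of_real field_simps power2_eq_square)
qed

lemma inner_from_sides:
  fixes p q r :: complex
  shows "(q - p) \<bullet> (r - p) = ((norm (q - p))\<^sup>2 + (norm (r - p))\<^sup>2 - (norm (r - q))\<^sup>2) / 2"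
proof -
  have "2 * ((q - p) \<bullet> (r - p)) = (norm (q - p))\<^sup>2 + (norm (r - p))\<^sup>2 - (norm (r - q))\<^sup>2"
    unfolding cmod_power2 inner_complex_def minus_complex.sel
    by (simp add: power2_eq_square algebra_simps)
  then show ?thesis by simp
qed

lemma cis_third_side:
  "(4 * (cos \<alpha>)\<^sup>2 - 1) *\<^sub>R cis \<alpha> - of_real (2 * cos \<alpha>) = cis \<alpha> powi 3"
proof -
  have "cis \<alpha> powi 3 = cis (3 * \<alpha>)"
    using cis_power_int[of \<alpha> 3] by simp
  moreover have "cos (3 * \<alpha>) = 4 * cos \<alpha> ^ 3 - 3 * cos \<alpha>"
    by (rule cos_treble_cos)
  moreover have "sin (3 * \<alpha>) = (4 * (cos \<alpha>)\<^sup>2 - 1) * sin \<alpha>"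
  proof -
    have "sin (3 * \<alpha>) = sin (2 * \<alpha> + \<alpha>)" by simp
    also have "\<dots> = (4 * (cos \<alpha>)\<^sup>2 - 1) * sin \<alpha>"
      unfolding sin_add sin_double cos_double_cos by (simp add: power2_eq_square algebra_simps)
    finally show ?thesis .
  qed
  ultimately show ?thesis
    by (simp add: complex_eq_iff power2_eq_square power3_eq_cube algebra_simps)
qed

text \<open>The side lengths determine the cosine of the angle at \<open>p\<close>, and the orientation the sign of its sine. The
  exponent 3 is the exterior angle \<pi> - \<beta> = 3\<alpha> at \<open>q\<close>; the last edge runs towards \<open>p\<close>, hence
  against the direction at angle \<alpha>.\<close>

lemma direct_copy_edges:
  fixes p q r :: complex and x :: real
  assumes x_def: "x = 2 * cos \<alpha>" and s: "sin \<alpha> > 0" and a: "a > 0" and x: "x > 1"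
    and pq: "norm (q - p) = a * x" and pr: "norm (r - p) = a * (x\<^sup>2 - 1)" and qr: "norm (r - q) = a"
    and c: "ccw p q r"
  shows "\<exists>w. norm w = 1 \<and> q - p = (a * x) *\<^sub>R w \<and> r - q = a *\<^sub>R (cis \<alpha> powi 3 * w)
      \<and> p - r = (- (a * (x\<^sup>2 - 1))) *\<^sub>R (cis \<alpha> powi 1 * w)"
proof -
  have c0: "a * x > 0" and b0: "a * (x\<^sup>2 - 1) > 0"
    using a x by (auto simp: one_less_power)
  define w where "w = (1 / (a * x)) *\<^sub>R (q - p)"
  have w: "q - p = (a * x) *\<^sub>R w"
    using a x by (simp add: w_def)
  have "(q - p) \<bullet> (r - p) = (a * (x\<^sup>2 - 1)) * (a * x) * cos \<alpha>"
  proof -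
    have "cos \<alpha> = x / 2" by (simp add: x_def)
    then show ?thesis
      unfolding inner_from_sides pq pr qr \<open>cos \<alpha> = x / 2\<close>
      by (simp add: power2_eq_square algebra_simps add_divide_distrib diff_divide_distrib)
  qed
  then have "r - p = ((a * (x\<^sup>2 - 1)) / (a * x)) *\<^sub>R (cis \<alpha> * (q - p))"
    using rotate_by_angle[OF pq pr c0 b0] c s by (simp add: ccw_def)
  then have rp: "r - p = (a * (x\<^sup>2 - 1)) *\<^sub>R (cis \<alpha> * w)"
    using a x by (simp add: w_def)
  have "r - q = (r - p) - (q - p)" by simp
  also have "\<dots> = a *\<^sub>R (((4 * (cos \<alpha>)\<^sup>2 - 1) *\<^sub>R cis \<alpha> - of_real (2 * cos \<alpha>)) * w)"
    unfolding rp w by (simp add: x_def power2_eq_square algebra_simps scaleR_conv_of_real)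
  finally have "r - q = a *\<^sub>R (cis \<alpha> powi 3 * w)"
    unfolding cis_third_side .
  moreover have "norm w = 1"
    using a x pq by (simp add: w_def)
  moreover have "p - r = (- (a * (x\<^sup>2 - 1))) *\<^sub>R (cis \<alpha> powi 1 * w)"
    using arg_cong[OF rp, of uminus] by simp
  ultimately show ?thesis using w by blast
qed

text \<open>This is the complex conjugate of the direct case. The side opposite \<beta> now comes first, so the
  exponents shift by one.\<close>

lemma reflected_copy_edges:
  fixes p q r :: complex and x :: real
  assumes x_def: "x = 2 * cos \<alpha>" and s: "sin \<alpha> > 0" and a: "a > 0" and x: "x > 1"
    and pq: "norm (q - p) = a * x" and pr: "norm (r - p) = a * (x\<^sup>2 - 1)" and qr: "norm (r - q) = a"
    and c: "ccw p r q"
  shows "\<exists>w. norm w = 1 \<and> r - p = (a * (x\<^sup>2 - 1)) *\<^sub>R w \<and> q - r = (- a) *\<^sub>R (cis \<alpha> powi (-2) * w)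
      \<and> p - q = (- (a * x)) *\<^sub>R (cis \<alpha> powi 1 * w)"
proof -
  have c': "ccw (cnj p) (cnj q) (cnj r)"
    using c by (simp add: ccw_def cross_def algebra_simps)
  have n: "norm (cnj q - cnj p) = a * x" "norm (cnj r - cnj p) = a * (x\<^sup>2 - 1)"
    "norm (cnj r - cnj q) = a"
    using pq pr qr by (metis complex_cnj_diff complex_mod_cnj)+
  obtain v where v: "norm v = 1" "cnj q - cnj p = (a * x) *\<^sub>R v"
      "cnj r - cnj q = a *\<^sub>R (cis \<alpha> powi 3 * v)"
      "cnj p - cnj r = (- (a * (x\<^sup>2 - 1))) *\<^sub>R (cis \<alpha> powi 1 * v)"
    using direct_copy_edges[OF x_def s a x n c'] by blast
  define w where "w = cnj (cis \<alpha> * v)"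
  have cc: "cis \<alpha> * cnj (cis \<alpha>) = 1" "cis \<alpha> \<noteq> 0"
    by (simp_all add: cis_cnj cis_mult)
  have cv1: "cnj v = cis \<alpha> powi 1 * w"
  proof -
    have "cis \<alpha> powi 1 * w = (cis \<alpha> * cnj (cis \<alpha>)) * cnj v"
      unfolding w_def by (simp only: complex_cnj_mult mult.assoc power_int_1_right)
    then show ?thesis unfolding cc(1) by simp
  qed
  have "cnj (cis \<alpha> powi 3) = cis \<alpha> powi (-3)"
    unfolding cis_power_int cis_cnj by simp
  then have "cnj (cis \<alpha> powi 3 * v) = cis \<alpha> powi (-3) * cis \<alpha> powi 1 * w"
    unfolding complex_cnj_mult cv1 by (simp only: mult.assoc)
  also have "cis \<alpha> powi (-3) * cis \<alpha> powi 1 = cis \<alpha> powi (-2)"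
    using power_int_add[of "cis \<alpha>" "-3" 1] by simp
  finally have cv3: "cnj (cis \<alpha> powi 3 * v) = cis \<alpha> powi (-2) * w" .
  have cv2: "cnj (cis \<alpha> powi 1 * v) = w"
    by (simp add: w_def)
  have "r - p = - cnj (cnj p - cnj r)" by simp
  also have "\<dots> = (a * (x\<^sup>2 - 1)) *\<^sub>R w"
    unfolding v(4) complex_cnj_scaleR cv2 by simp
  finally have "r - p = (a * (x\<^sup>2 - 1)) *\<^sub>R w" .
  moreover have "q - r = - cnj (cnj r - cnj q)" by simp
  then have "q - r = (- a) *\<^sub>R (cis \<alpha> powi (-2) * w)"
    unfolding v(3) complex_cnj_scaleR cv3 by simp
  moreover have "p - q = - cnj (cnj q - cnj p)" by simp
  then have "p - q = (- (a * x)) *\<^sub>R (cis \<alpha> powi 1 * w)"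
    unfolding v(2) complex_cnj_scaleR cv1 by simp
  moreover have "norm w = 1" using v(1) by (simp add: w_def norm_mult)
  ultimately show ?thesis by blast
qed

lemma cross_square: "(cross v w)\<^sup>2 = (norm v)\<^sup>2 * (norm w)\<^sup>2 - (v \<bullet> w)\<^sup>2"
  unfolding cmod_power2 cross_def inner_complex_def by (simp add: power2_eq_square algebra_simps)

lemma cross_square_angle:
  assumes "v \<bullet> w = norm v * norm w * cos \<alpha>"
  shows "(cross v w)\<^sup>2 = (norm v * norm w * sin \<alpha>)\<^sup>2"
  unfolding cross_square assms
  by (simp add: power_mult_distrib sin_squared_eq right_diff_distrib)

lemma directed_edge:
  assumes "norm u = 1" "norm w = 1"
  shows "horizontal_length ((t *\<^sub>R (cis \<alpha> powi j * w)) / (cis \<alpha> powi k * u))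
     = t * dir_sign \<alpha> u w (k - j)"
proof -
  have "norm (cis \<alpha> powi j * w) = 1"
    using assms by (simp add: norm_mult norm_power_int)
  moreover have "u \<noteq> 0" using assms by auto
  ultimately show ?thesis
    using horizontal_length_dir_sign[OF assms(1)] dir_sign_shift by metis
qed

lemma angle_quotient_bounds:
  "-1 \<le> ((X - Y) \<bullet> (Z - Y)) / (norm (X - Y) * norm (Z - Y)) \<and>
   ((X - Y) \<bullet> (Z - Y)) / (norm (X - Y) * norm (Z - Y)) \<le> 1"
proof -
  have "\<bar>((X - Y) \<bullet> (Z - Y)) / (norm (X - Y) * norm (Z - Y))\<bar> \<le> 1"
  proof (cases "X = Y \<or> Z = Y")
    case False
    then have "0 < norm (X - Y) * norm (Z - Y)" by simp
    then show ?thesis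
      using Cauchy_Schwarz_ineq2[of "X - Y" "Z - Y"]
      by (simp add: abs_mult divide_le_eq_1_pos)
  qed auto
  then show ?thesis by linarith
qed

lemma angle_at_range: "0 \<le> angle_at Y X Z" "angle_at Y X Z \<le> pi"
  using angle_quotient_bounds[of X Y Z] by (simp_all add: angle_at_def arccos_lbound arccos_ubound)

lemma inner_angle_at:
  assumes "X \<noteq> Y" "Z \<noteq> Y"
  shows "(X - Y) \<bullet> (Z - Y) = dist X Y * dist Z Y * cos (angle_at Y X Z)"
  using assms angle_quotient_bounds[of X Y Z] by (simp add: angle_at_def cos_arccos dist_norm)

lemma proper_triangle_distinct:
  assumes "proper_triangle X Y Z" shows "X \<noteq> Y" "Y \<noteq> Z" "Z \<noteq> X"
  using assms unfolding proper_triangle_def by (auto simp: insert_commute)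

text \<open>Computing the area of \<open>PQR\<close> at \<open>P\<close> and at \<open>R\<close> gives \<open>c sin \<alpha> = a sin 2\<alpha>\<close>, and projecting the
  other two sides onto \<open>PR\<close> gives \<open>b = c cos \<alpha> + a cos 2\<alpha>\<close>.\<close>

lemma tile_sides:
  assumes pr: "proper_triangle P Q R"
    and aP: "angle_at P Q R = \<alpha>" and aR: "angle_at R P Q = 2 * \<alpha>" and "\<alpha> \<noteq> 0"
  defines "x \<equiv> 2 * cos \<alpha>"
  shows "0 < sin \<alpha>" and "1 < x" and "dist P Q = dist Q R * x" and "dist P R = dist Q R * (x\<^sup>2 - 1)"
proof -
  define a b c where "a = dist Q R" and "b = dist P R" and "c = dist P Q"
  note d = proper_triangle_distinct[OF pr]
  have pos: "a > 0" "b > 0" "c > 0"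
    using d by (auto simp: a_def b_def c_def)
  have range: "0 \<le> \<alpha>" "2 * \<alpha> \<le> pi"
    using angle_at_range[of R P Q] aR by auto
  with \<open>\<alpha> \<noteq> 0\<close> show s: "0 < sin \<alpha>"
    using pi_gt_zero by (intro sin_gt_zero) linarith+
  have s2: "0 \<le> sin (2 * \<alpha>)"
    using range by (intro sin_ge_zero) auto
  have i1: "(Q - P) \<bullet> (R - P) = c * b * cos \<alpha>"
    using inner_angle_at[of Q P R] d aP by (simp add: b_def c_def dist_commute)
  have i2: "(P - R) \<bullet> (Q - R) = b * a * cos (2 * \<alpha>)"
    using inner_angle_at[of P R Q] d aR by (simp add: a_def b_def)
  have n: "norm (Q - P) = c" "norm (R - P) = b" "norm (P - R) = b" "norm (Q - R) = a"
    by (simp_all add: a_def b_def c_def dist_norm norm_minus_commute)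
  have cr1: "(cross (cpx (Q - P)) (cpx (R - P)))\<^sup>2 = (c * b * sin \<alpha>)\<^sup>2"
    using cross_square_angle[of "cpx (Q - P)" "cpx (R - P)" \<alpha>] i1 by (simp add: norm_cpx inner_cpx n)
  have cr2: "(cross (cpx (P - R)) (cpx (Q - R)))\<^sup>2 = (b * a * sin (2 * \<alpha>))\<^sup>2"
    using cross_square_angle[of "cpx (P - R)" "cpx (Q - R)" "2 * \<alpha>"] i2 by (simp add: norm_cpx inner_cpx n)
  have "cross (cpx (Q - P)) (cpx (R - P)) = cross (cpx (P - R)) (cpx (Q - R))"
    unfolding cpx_diff by (simp add: cross_def algebra_simps)
  then have "(c * b * sin \<alpha>)\<^sup>2 = (b * a * sin (2 * \<alpha>))\<^sup>2"
    using cr1 cr2 by simp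
  then have "c * b * sin \<alpha> = b * a * sin (2 * \<alpha>)"
    by (rule power2_eq_imp_eq) (use pos s s2 in simp_all)
  then have c: "c = a * x"
    using pos s unfolding sin_double by (simp add: x_def)
  have "b\<^sup>2 = (Q - P) \<bullet> (R - P) + (P - R) \<bullet> (Q - R)"
    unfolding n(2)[symmetric] power2_norm_eq_inner
    by (simp add: inner_diff_left inner_diff_right inner_commute)
  then have "b * b = b * (c * cos \<alpha> + a * cos (2 * \<alpha>))"
    unfolding i1 i2 by (simp add: power2_eq_square algebra_simps)
  then have "b = c * cos \<alpha> + a * cos (2 * \<alpha>)"
    using pos by simp
  then have b: "b = a * (x\<^sup>2 - 1)"
    unfolding c cos_double_cos by (simp add: x_def power2_eq_square algebra_simps)
  have "x > 0" using c pos by (simp add: zero_less_mult_iff)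
  moreover have "1 < x\<^sup>2" using b pos by (simp add: zero_less_mult_iff)
  ultimately show "1 < x"
    by (metis less_imp_le one_power2 power2_less_imp_less)
  show "dist P Q = dist Q R * x" "dist P R = dist Q R * (x\<^sup>2 - 1)"
    using b c by (simp_all add: a_def b_def c_def)
qed

lemma isometry_image_triangle:
  fixes f :: "real^2 \<Rightarrow> real^2"
  assumes "\<And>x y. dist (f x) (f y) = dist x y"
  shows "f ` (convex hull {P, Q, R}) = convex hull {f P, f Q, f R}"
proof -
  define g where "g v = f v - f 0" for v
  have "orthogonal_transformation g"
    unfolding orthogonal_transformation_isometry using assms by (simp add: g_def dist_norm)
  then have "linear g" by (rule orthogonal_transformation_linear)
  have "f ` S = (+) (f 0) ` g ` S" for S
    unfolding image_image g_def by simp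
  then have "f ` (convex hull {P, Q, R}) = convex hull (f ` {P, Q, R})"
    by (simp only: convex_hull_linear_image[OF \<open>linear g\<close>] convex_hull_translation)
  then show ?thesis by simp
qed

lemma copy_directed_boundary:
  fixes P Q R :: "real^2" and x a :: real
  assumes x_def: "x = 2 * cos \<alpha>" and s: "sin \<alpha> > 0" and a: "a > 0" and x: "x > 1"
    and PQ: "dist P Q = a * x" and PR: "dist P R = a * (x\<^sup>2 - 1)" and QR: "dist Q R = a"
    and u: "norm u = 1"
  shows "\<exists>X Y Z w \<delta>. {X, Y, Z} = {P, Q, R} \<and> ccw (cpx X) (cpx Y) (cpx Z) \<and>
     (\<forall>k. directed_boundary (cis \<alpha> powi k * u) (cpx X) (cpx Y) (cpx Z) = a *
       (if \<delta> then direct_outline x (dir_sign \<alpha> u w) k else reflected_outline x (dir_sign \<alpha> u w) k))"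
proof -
  let ?p = "cpx P" and ?q = "cpx Q" and ?r = "cpx R"
  have n: "norm (?q - ?p) = a * x" "norm (?r - ?p) = a * (x\<^sup>2 - 1)" "norm (?r - ?q) = a"
    using PQ PR QR by (simp_all add: dist_norm norm_minus_commute norm_cpx flip: cpx_diff)
  have c: "cos \<alpha> = x / 2" using x_def by simp
  have inner: "(?q - ?p) \<bullet> (?r - ?p) = (a * x) * (a * (x\<^sup>2 - 1)) * cos \<alpha>"
    unfolding inner_from_sides n c
    by (simp add: power2_eq_square algebra_simps add_divide_distrib diff_divide_distrib)
  have pos: "a * x > 0" "a * (x\<^sup>2 - 1) > 0"
    using a x by (auto simp: one_less_power)
  have "(cross (?q - ?p) (?r - ?p))\<^sup>2 = ((a * x) * (a * (x\<^sup>2 - 1)) * sin \<alpha>)\<^sup>2"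
    using cross_square_angle[of "?q - ?p" "?r - ?p" \<alpha>] inner unfolding n(1,2) .
  then have "cross (?q - ?p) (?r - ?p) \<noteq> 0"
    using pos s by (metis mult_pos_pos less_irrefl zero_eq_power2)
  moreover have "cross (?r - ?p) (?q - ?p) = - cross (?q - ?p) (?r - ?p)"
    by (simp add: cross_def)
  ultimately consider "ccw ?p ?q ?r" | "ccw ?p ?r ?q"
    by (fastforce simp: ccw_def)
  then show ?thesis
  proof cases
    case 1
    obtain w where w: "norm w = 1" "?q - ?p = (a * x) *\<^sub>R w" "?r - ?q = a *\<^sub>R (cis \<alpha> powi 3 * w)"
      "?p - ?r = (- (a * (x\<^sup>2 - 1))) *\<^sub>R (cis \<alpha> powi 1 * w)"
      using direct_copy_edges[OF x_def s a x n 1] by blast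
    have "?q - ?p = (a * x) *\<^sub>R (cis \<alpha> powi 0 * w)" using w(2) by simp
    then have "directed_boundary (cis \<alpha> powi k * u) ?p ?q ?r = a * direct_outline x (dir_sign \<alpha> u w) k" for k
      unfolding directed_boundary_def direct_outline_def w(3,4) by (simp only: directed_edge[OF u w(1)]) (simp add: algebra_simps)
    then show ?thesis using 1
      by (intro exI[of _ P] exI[of _ Q] exI[of _ R] exI[of _ w] exI[of _ True]) simp
  next
    case 2
    obtain w where w: "norm w = 1" "?r - ?p = (a * (x\<^sup>2 - 1)) *\<^sub>R w"
      "?q - ?r = (- a) *\<^sub>R (cis \<alpha> powi (-2) * w)" "?p - ?q = (- (a * x)) *\<^sub>R (cis \<alpha> powi 1 * w)"
      using reflected_copy_edges[OF x_def s a x n 2] by blast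
    have "?r - ?p = (a * (x\<^sup>2 - 1)) *\<^sub>R (cis \<alpha> powi 0 * w)" using w(2) by simp
    then have "directed_boundary (cis \<alpha> powi k * u) ?p ?r ?q = a * reflected_outline x (dir_sign \<alpha> u w) k" for k
      unfolding directed_boundary_def reflected_outline_def w(3,4) by (simp only: directed_edge[OF u w(1)]) (simp add: algebra_simps)
    then show ?thesis using 2
      by (intro exI[of _ P] exI[of _ R] exI[of _ Q] exI[of _ w] exI[of _ False]) auto
  qed
qed

text \<open>With \<open>u\<close> the direction of the base, the legs run against the directions with exponents -1 and 1,
  and the base is \<open>2 cos \<alpha>\<close> times as long as a leg.\<close>

lemma isosceles_directed_boundary:
  fixes A B C :: "real^2"
  assumes irr: "\<not> (\<exists>q\<in>\<rat>. \<alpha> = q * pi)" and s: "sin \<alpha> > 0"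
    and iso: "isosceles_triangle A B C"
    and angA: "angle_at A B C = \<alpha>" and angB: "angle_at B A C = \<alpha>"
    and c: "ccw (cpx A) (cpx B) (cpx C)"
  defines "x \<equiv> 2 * cos \<alpha>"
  shows "\<exists>u. norm u = 1 \<and> (\<forall>k. directed_boundary (cis \<alpha> powi k * u) (cpx A) (cpx B) (cpx C)
     = dist A C * (x * of_bool (k = 0) - of_bool (k = 1) - of_bool (k = -1)))"
proof -
  define L M where "L = dist A B" and "M = dist A C"
  have BC: "dist B C = M" and d: "A \<noteq> B" "B \<noteq> C" "C \<noteq> A"
    using iso proper_triangle_distinct[of A B C] by (auto simp: isosceles_triangle_def M_def)
  have pos: "L > 0" "M > 0" using d by (auto simp: L_def M_def)
  have i1: "(B - A) \<bullet> (C - A) = M * L * cos \<alpha>"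
    using inner_angle_at[of B A C] d angA by (simp add: L_def M_def dist_commute)
  have i2: "(A - B) \<bullet> (C - B) = M * L * cos \<alpha>"
    using inner_angle_at[of A B C] d angB BC by (simp add: L_def dist_commute)
  have n: "norm (B - A) = L" "norm (C - A) = M"
    by (simp_all add: L_def M_def dist_norm norm_minus_commute)
  have "L\<^sup>2 = (B - A) \<bullet> (C - A) + (A - B) \<bullet> (C - B)"
    unfolding n(1)[symmetric] power2_norm_eq_inner
    by (simp add: inner_diff_left inner_diff_right inner_commute)
  then have "L * L = L * (M * x)"
    unfolding i1 i2 by (simp add: x_def power2_eq_square algebra_simps)
  then have L: "L = M * x" using pos by simp
  define u where "u = (1 / L) *\<^sub>R (cpx B - cpx A)"
  have u: "norm u = 1"
    using pos n by (simp add: u_def norm_cpx flip: cpx_diff)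
  have e1: "cpx B - cpx A = (M * x) *\<^sub>R (cis \<alpha> powi 0 * u)"
    using pos unfolding L[symmetric] by (simp add: u_def)
  have "cpx C - cpx A = (M / L) *\<^sub>R (cis \<alpha> * (cpx B - cpx A))"
    by (rule rotate_by_angle)
      (use pos n i1 c s in \<open>simp_all add: ccw_def norm_cpx inner_cpx flip: cpx_diff\<close>)
  then have CA: "cpx C - cpx A = M *\<^sub>R (cis \<alpha> * u)"
    using pos by (simp add: u_def)
  have "cpx A - cpx C = - (cpx C - cpx A)" by simp
  then have e3: "cpx A - cpx C = (- M) *\<^sub>R (cis \<alpha> powi 1 * u)"
    unfolding CA by simp
  have "cpx C - cpx B = (cpx C - cpx A) - (cpx B - cpx A)" by simp
  also have "\<dots> = M *\<^sub>R ((cis \<alpha> - of_real (2 * cos \<alpha>)) * u)"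
    unfolding CA e1 by (simp add: x_def algebra_simps scaleR_conv_of_real)
  also have "cis \<alpha> - of_real (2 * cos \<alpha>) = - (cis \<alpha> powi (-1))"
    unfolding cis_power_int by (simp add: complex_eq_iff)
  finally have e2: "cpx C - cpx B = (- M) *\<^sub>R (cis \<alpha> powi (-1) * u)"
    by simp
  have u0: "u \<noteq> 0" using u by auto
  have "directed_boundary (cis \<alpha> powi k * u) (cpx A) (cpx B) (cpx C)
     = M * (x * of_bool (k = 0) - of_bool (k = 1) - of_bool (k = -1))" for k
    unfolding directed_boundary_def e1 e2 e3
    by (simp only: directed_edge[OF u u] dir_sign_self[OF irr u0]) (auto simp: algebra_simps)
  then show ?thesis using u unfolding M_def by blast
qed

section \<open>Rationality of the tile\<close>

text \<open>Tiles whose edges are not in any of the directions \<open>cis \<alpha> powi k * u\<close> have \<open>dir_sign\<close> 0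
  throughout and drop out of the count, so nothing has to be known about how they are placed.\<close>

lemma tiling_imp_rational_ratio:
  fixes A B C P Q R :: "real^2"
  assumes iso: "isosceles_triangle A B C" and c: "ccw (cpx A) (cpx B) (cpx C)"
    and angA: "angle_at A B C = \<alpha>" and angB: "angle_at B A C = \<alpha>"
    and pr: "proper_triangle P Q R"
    and aP: "angle_at P Q R = \<alpha>" and aR: "angle_at R P Q = 2 * \<alpha>"
    and irr: "\<not> (\<exists>q\<in>\<rat>. \<alpha> = q * pi)"
    and til: "is_tiling N \<T> (convex hull {A, B, C}) (convex hull {P, Q, R})"
  shows "2 * cos \<alpha> \<in> \<rat>"
proof (rule ccontr)
  define x where "x = 2 * cos \<alpha>"
  assume "2 * cos \<alpha> \<notin> \<rat>"
  then have xirr: "x \<notin> \<rat>" by (simp add: x_def)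
  define a M where "a = dist Q R" and "M = dist A C"
  have "\<alpha> \<noteq> 0" using irr by (metis Rats_0 mult_zero_left)
  from tile_sides[OF pr aP aR this]
  have s: "0 < sin \<alpha>" and x: "1 < x" and PQ: "dist P Q = a * x" and PR: "dist P R = a * (x\<^sup>2 - 1)"
    by (auto simp: x_def a_def)
  have a: "a > 0" using proper_triangle_distinct[OF pr] by (simp add: a_def)
  obtain u where u: "norm u = 1" and bd: "\<And>k. directed_boundary (cis \<alpha> powi k * u) (cpx A) (cpx B) (cpx C)
     = M * (x * of_bool (k = 0) - of_bool (k = 1) - of_bool (k = -1))"
    using isosceles_directed_boundary[OF irr s iso angA angB c] unfolding x_def M_def by blast
  have u0: "u \<noteq> 0" using u by auto
  let ?d = "dir_sign \<alpha> u"
  have "\<forall>t\<in>\<T>. \<exists>X Y Z w \<delta>. t = convex hull {X, Y, Z} \<and> ccw (cpx X) (cpx Y) (cpx Z) \<and>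
     (\<forall>k. directed_boundary (cis \<alpha> powi k * u) (cpx X) (cpx Y) (cpx Z) = a *
       (if \<delta> then direct_outline x (?d w) k else reflected_outline x (?d w) k))"
  proof
    fix t assume "t \<in> \<T>"
    then obtain f where f: "\<And>x y. dist (f x) (f y) = dist x y" "t = f ` (convex hull {P, Q, R})"
      using til unfolding is_tiling_def congruent_sets_def by metis
    have t: "t = convex hull {f P, f Q, f R}"
      using isometry_image_triangle[OF f(1)] f(2) by simp
    have "dist (f P) (f Q) = a * x" "dist (f P) (f R) = a * (x\<^sup>2 - 1)" "dist (f Q) (f R) = a"
      using f(1) PQ PR by (simp_all add: a_def)
    from copy_directed_boundary[OF x_def s a x this u]
    obtain X Y Z w \<delta> where hull: "{X, Y, Z} = {f P, f Q, f R}"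
      and XYZ: "ccw (cpx X) (cpx Y) (cpx Z)"
        "\<forall>k. directed_boundary (cis \<alpha> powi k * u) (cpx X) (cpx Y) (cpx Z) = a *
         (if \<delta> then direct_outline x (?d w) k else reflected_outline x (?d w) k)"
      by blast
    have "t = convex hull {X, Y, Z}"
      unfolding hull by (rule t)
    with XYZ show "\<exists>X Y Z w \<delta>. t = convex hull {X, Y, Z} \<and> ccw (cpx X) (cpx Y) (cpx Z) \<and>
     (\<forall>k. directed_boundary (cis \<alpha> powi k * u) (cpx X) (cpx Y) (cpx Z) = a *
       (if \<delta> then direct_outline x (?d w) k else reflected_outline x (?d w) k))"
      by blast
  qed
  then obtain X Y Z w \<delta> where tile: "\<And>t. t \<in> \<T> \<Longrightarrow> t = convex hull {X t, Y t, Z t}"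
      "\<And>t. t \<in> \<T> \<Longrightarrow> ccw (cpx (X t)) (cpx (Y t)) (cpx (Z t))"
    and db: "\<And>t k. t \<in> \<T> \<Longrightarrow> directed_boundary (cis \<alpha> powi k * u) (cpx (X t)) (cpx (Y t)) (cpx (Z t)) = a *
       (if \<delta> t then direct_outline x (?d (w t)) k else reflected_outline x (?d (w t)) k)"
    by metis
  have fin: "finite \<T>" using til by (simp add: is_tiling_def)
  \<comment> \<open>Signed numbers of direct and of reflected tiles whose first edge has the \<open>k\<close>-th direction.\<close>
  define p q where "p k = (\<Sum>t\<in>\<T>. if \<delta> t then ?d (w t) k else 0)"
    and "q k = (\<Sum>t\<in>\<T>. if \<delta> t then 0 else ?d (w t) k)" for k
  have supp: "finite (\<Union>t\<in>\<T>. {k. ?d (w t) k \<noteq> 0})"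
    using fin finite_dir_sign_support[OF irr u0] by blast
  have pq0: "p k = 0 \<and> q k = 0" if "k \<notin> (\<Union>t\<in>\<T>. {k. ?d (w t) k \<noteq> 0})" for k
    using that unfolding p_def q_def by (auto intro!: sum.neutral)
  have finp: "finite {k. p k \<noteq> 0}" and finq: "finite {k. q k \<noteq> 0}"
  proof -
    have "{k. p k \<noteq> 0} \<subseteq> (\<Union>t\<in>\<T>. {k. ?d (w t) k \<noteq> 0})"
      "{k. q k \<noteq> 0} \<subseteq> (\<Union>t\<in>\<T>. {k. ?d (w t) k \<noteq> 0})"
      using pq0 by blast+
    then show "finite {k. p k \<noteq> 0}" "finite {k. q k \<noteq> 0}"
      using supp finite_subset by blast+
  qed
  have sum: "(\<Sum>t\<in>\<T>. directed_boundary (cis \<alpha> powi k * u) (cpx (X t)) (cpx (Y t)) (cpx (Z t)))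
      = M * (x * of_bool (k = 0) - of_bool (k = 1) - of_bool (k = -1))" for k
  proof -
    have "(\<Sum>t\<in>\<T>. directed_boundary (cis \<alpha> powi k * u) (cpx (X t)) (cpx (Y t)) (cpx (Z t)))
        = directed_boundary (cis \<alpha> powi k * u) (cpx A) (cpx B) (cpx C)"
    proof (rule directed_boundary_additive[OF _ fin tile(2) c])
      show "norm (cis \<alpha> powi k * u) = 1"
        using u by (simp add: norm_mult norm_power_int)
      have "(\<Union>t\<in>\<T>. convex hull {X t, Y t, Z t}) = \<Union>\<T>"
        using tile(1) by auto
      then show "(\<Union>t\<in>\<T>. convex hull {X t, Y t, Z t}) = convex hull {A, B, C}"
        using til by (simp add: is_tiling_def)
      show "interior (convex hull {X i, Y i, Z i}) \<inter> interior (convex hull {X j, Y j, Z j}) = {}"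
        if "i \<in> \<T>" "j \<in> \<T>" "i \<noteq> j" for i j
        using til that tile(1)[of i] tile(1)[of j] unfolding is_tiling_def pairwise_def by metis
    qed
    then show ?thesis using bd by simp
  qed
  have "M / a = 0"
  proof (rule direction_equations_imp_zero[OF finp finq xirr])
    fix k
    have "(\<Sum>t\<in>\<T>. directed_boundary (cis \<alpha> powi k * u) (cpx (X t)) (cpx (Y t)) (cpx (Z t)))
       = (\<Sum>t\<in>\<T>. a * (direct_outline x (\<lambda>j. if \<delta> t then ?d (w t) j else 0) k
            + reflected_outline x (\<lambda>j. if \<delta> t then 0 else ?d (w t) j) k))"
      by (intro sum.cong refl) (simp add: db direct_outline_def reflected_outline_def)
    also have "\<dots> = a * (direct_outline x p k + reflected_outline x q k)"
      unfolding p_def q_def direct_outline_sum reflected_outline_sum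
      by (simp only: sum.distrib flip: sum_distrib_left)
    finally show "direct_outline x p k + reflected_outline x q k
       = M / a * (x * of_bool (k = 0) - of_bool (k = 1) - of_bool (k = -1))"
      using a unfolding sum by (simp add: eq_divide_eq mult.commute)
  qed
  moreover have "M > 0"
    using iso proper_triangle_distinct[of A B C] by (auto simp: M_def isosceles_triangle_def)
  ultimately show False using a by simp
qed

lemma isosceles_ccw_cases:
  assumes iso: "isosceles_triangle A B C" and "angle_at A B C = \<alpha>" and s: "sin \<alpha> > 0"
  shows "ccw (cpx A) (cpx B) (cpx C) \<or> ccw (cpx B) (cpx A) (cpx C)"
proof -
  have d: "A \<noteq> B" "B \<noteq> C" "C \<noteq> A"
    using iso proper_triangle_distinct[of A B C] by (auto simp: isosceles_triangle_def)
  have i: "(B - A) \<bullet> (C - A) = norm (B - A) * norm (C - A) * cos \<alpha>"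
    using inner_angle_at[of B A C] d assms(2) by (simp add: dist_norm)
  have "(cross (cpx (B - A)) (cpx (C - A)))\<^sup>2 = (norm (B - A) * norm (C - A) * sin \<alpha>)\<^sup>2"
    using cross_square_angle[of "cpx (B - A)" "cpx (C - A)" \<alpha>] i by (simp add: norm_cpx inner_cpx)
  then have "cross (cpx (B - A)) (cpx (C - A)) \<noteq> 0"
    using d s by auto
  moreover have "cross (cpx (A - B)) (cpx (C - B)) = - cross (cpx (B - A)) (cpx (C - A))"
    unfolding cpx_diff by (simp add: cross_def algebra_simps)
  ultimately show ?thesis
    unfolding ccw_def cpx_diff by linarith
qed

text \<open>The orientation of \<open>ABC\<close> is arbitrary; if it is clockwise, exchanging the base vertices makes it anticlockwise. The
  side ratios are then rational functions of \<open>2 cos \<alpha>\<close>.\<close>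

theorem theorem10p7:
  fixes A B C P Q R :: "real^2" and \<alpha> \<beta> :: real and N :: nat and \<T> :: "(real^2) set set"
  assumes "isosceles_triangle A B C"
    and "angle_at A B C = \<alpha>" and "angle_at B A C = \<alpha>"
    and "proper_triangle P Q R"
    and "angle_at P Q R = \<alpha>" and "angle_at Q P R = \<beta>" and "angle_at R P Q = 2 * \<alpha>"
    and "\<not> (\<exists>q\<in>\<rat>. \<alpha> = q * pi)"
    and "is_tiling N \<T> (convex hull {A, B, C}) (convex hull {P, Q, R})"
  shows "rational_triangle P Q R"
proof -
  define x where "x = 2 * cos \<alpha>"
  have "\<alpha> \<noteq> 0" using assms(8) by (metis Rats_0 mult_zero_left)
  note sides = tile_sides[OF assms(4,5,7) this, folded x_def]
  have pos: "dist Q R > 0" using proper_triangle_distinct[OF assms(4)] by simp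
  have iso': "isosceles_triangle B A C"
    using assms(1) by (auto simp: isosceles_triangle_def proper_triangle_def dist_commute insert_commute)
  have hull: "{B, A, C} = {A, B, C}" by auto
  have "x \<in> \<rat>"
    using isosceles_ccw_cases[OF assms(1,2) sides(1)]
      tiling_imp_rational_ratio[OF assms(1) _ assms(2-5,7-9)]
      tiling_imp_rational_ratio[OF iso' _ assms(3,2,4,5,7,8), unfolded hull, OF _ assms(9)]
    unfolding x_def by blast
  have "dist P Q / dist Q R = x" "dist Q R / dist R P = 1 / (x\<^sup>2 - 1)"
    "dist R P / dist P Q = (x\<^sup>2 - 1) / x"
    using pos sides by (simp_all add: dist_commute[of R P])
  then show ?thesis
    unfolding rational_triangle_def using \<open>x \<in> \<rat>\<close> by simp
qed

end
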